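(* The field $\mathbb{K}$ of generalised Puiseux series over $\mathbb{C}$, equipped with the norm $|f|=\exp(-\operatorname{val}(f))$, is complete, i.e. every Cauchy sequence in $\mathbb{K}$ with respect to $|\cdot|$ is convergent in $\mathbb{K}$ with respect to $|\cdot|$.
   Context: Let $\mathbb{M}$ be the collection of all subsets $A\subset\mathbb{R}$ such that either $A$ is finite (possibly empty), or $A=\{\alpha_n \mid n\in\mathbb{N}\}$ for some strictly increasing, unbounded sequence $(\alpha_n)_{n\in\mathbb{N}}$ of real numbers. For $A\in\mathbb{M}$ and $a_\alpha\in\mathbb{C}^*=\mathbb{C}\setminus\{0\}$ for $\alpha\in A$, the symbol $\sum_{\alpha\in A}a_\alpha\cdot t^\alpha$ denotes the function $f:\mathbb{R}\to\mathbb{C}$ with $f(\alpha)=a_\alpha$ if $\alpha\in A$ and $f(\alpha)=0$ otherwise. The set of generalised Puiseux series is $$\mathbb{K}=\Big\{\sum_{\alpha\in A}a_\alpha\cdot t^\alpha \;\Big|\; A\in\mathbb{M},\ a_\alpha\in\mathbb{C}^*\Big\},$$ i.e. the set of all functions $f:\mathbb{R}\to\mathbb{C}$ whose support $\{\alpha\in\mathbb{R}\mid f(\alpha)\neq 0\}$ belongs to $\mathbb{M}$ (the zero function is included, with $A=\emptyset$). For $f=\sum_{\alpha\in A}a_\alpha t^\alpha$ and $g=\sum_{\beta\in B}b_\beta t^\beta$ in $\mathbb{K}$, addition is pointwise, $(f+g)(\alpha)=f(\alpha)+g(\alpha)$, and multiplication is $$f\cdot g=\sum_{\gamma\in A*B}\Big(\sum_{\alpha\in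 A,\ \beta\in B,\ \alpha+\beta=\gamma}a_\alpha b_\beta\Big)\cdot t^\gamma,\qquad A*B=\{\alpha+\beta\mid\alpha\in A,\ \beta\in B\},$$ where coefficients in such an expression are allowed to be zero, and for each $\gamma$ the inner sum is finite. With these operations $\mathbb{K}$ is a field. The valuation on $\mathbb{K}$ is $\operatorname{val}(f)=\min\{\alpha\in\mathbb{R}\mid f(\alpha)\neq 0\}$ for $f\neq 0$, and $\operatorname{val}(0)=\infty$. The norm is $|\cdot|:\mathbb{K}\to\mathbb{R}$, $|f|=\exp(-\operatorname{val}(f))$, with the convention $\exp(-\infty)=0$; it satisfies $|f+g|\leq\max\{|f|,|g|\}$. A sequence $(f_n)_{n\in\mathbb{N}}$ in $\mathbb{K}$ is a Cauchy sequence if for all $\varepsilon>0$ there is $N(\varepsilon)\in\mathbb{N}$ such that $|f_n-f_m|<\varepsilon$ for all $n,m\geq N(\varepsilon)$. It is convergent if there is $f\in\mathbb{K}$ such that for all $\varepsilon>0$ there is $N(\varepsilon)\in\mathbb{N}$ with $|f_n-f|<\varepsilon$ for all $n\geq N(\varepsilon)$. *)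

theory Defs
  imports "HOL-Analysis.Analysis"
begin

definition puiseux_supports :: "real set set" where
  "puiseux_supports = {A. finite A \<or>
     (\<exists>a :: nat \<Rightarrow> real. strict_mono a \<and> \<not> bounded (range a) \<and> A = range a)}"

typedef gen_puiseux = "{f :: real \<Rightarrow> complex. {\<alpha>. f \<alpha> \<noteq> 0} \<in> puiseux_supports}"
  morphisms coeff Abs_gen_puiseux
proof
  show "(\<lambda>_. 0) \<in> {f :: real \<Rightarrow> complex. {\<alpha>. f \<alpha> \<noteq> 0} \<in> puiseux_supports}"
    by (simp add: puiseux_supports_def)
qed

definition supp :: "gen_puiseux \<Rightarrow> real set" where
  "supp f = {\<alpha>. coeff f \<alpha> \<noteq> 0}"

lemma supp_in: "supp f \<in> puiseux_supports"
  using coeff[of f] by (simp add: supp_def)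

lemma not_in_supp: "\<alpha> \<notin> supp f \<longleftrightarrow> coeff f \<alpha> = 0"
  by (simp add: supp_def)

lemma gen_puiseux_eqI: "(\<And>\<alpha>. coeff f \<alpha> = coeff g \<alpha>) \<Longrightarrow> f = g"
  by (metis coeff_inject ext)

lemma coeff_Abs: "{\<alpha>. f \<alpha> \<noteq> 0} \<in> puiseux_supports \<Longrightarrow> coeff (Abs_gen_puiseux f) = f"
  by (simp add: Abs_gen_puiseux_inverse)

lemma puiseux_supports_iff:
  "A \<in> puiseux_supports \<longleftrightarrow> (\<forall>x. finite {a \<in> A. a \<le> x})"
proof
  assume "A \<in> puiseux_supports"
  then consider "finite A" | a :: "nat \<Rightarrow> real"
    where "strict_mono a" "\<not> bounded (range a)" "A = range a"
    unfolding puiseux_supports_def by blast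
  then show "\<forall>x. finite {a \<in> A. a \<le> x}"
  proof cases
    case 2
    show ?thesis
    proof
      fix x
      have lb: "a 0 \<le> a n" for n
        using 2(1) by (simp add: strict_mono_less_eq)
      obtain n where n: "x < a n"
      proof (rule ccontr)
        assume "\<not> thesis"
        then have "a n \<le> x" for n using that by (meson not_le)
        with lb have "range a \<subseteq> {a 0..x}" by auto
        with 2(2) show False
          using bounded_closed_interval bounded_subset by blast
      qed
      have "{y \<in> A. y \<le> x} \<subseteq> a ` {..n}"
      proof
        fix y assume "y \<in> {y \<in> A. y \<le> x}"
        then obtain k where k: "y = a k" "a k \<le> x" using 2(3) by auto
        with n have "a k < a n" by simp
        then have "k < n" using 2(1) strict_mono_less by blast
        with k show "y \<in> a ` {..n}" by simp
      qed
      then show "finite {y \<in> A. y \<le> x}" using finite_surj by blast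
    qed
  qed simp
next
  assume fin: "\<forall>x. finite {a \<in> A. a \<le> x}"
  show "A \<in> puiseux_supports"
  proof (cases "finite A")
    case True
    then show ?thesis by (simp add: puiseux_supports_def)
  next
    case False
    have ex: "\<exists>m\<in>B. \<forall>b\<in>B. m \<le> b" if "B \<subseteq> A" "B \<noteq> {}" for B
    proof -
      obtain b where b: "b \<in> B" using \<open>B \<noteq> {}\<close> by blast
      have f: "finite {a \<in> B. a \<le> b}"
        by (rule finite_subset[OF _ fin[rule_format, of b]]) (use that in auto)
      define m where "m = Min {a \<in> B. a \<le> b}"
      have "m \<in> {a \<in> B. a \<le> b}" unfolding m_def using f b by (intro Min_in) auto
      moreover have "m \<le> a" if "a \<in> B" for a
      proof (cases "a \<le> b")
        case True
        then show ?thesis unfolding m_def using f that by (intro Min_le) auto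
      next
        case False
        then show ?thesis using \<open>m \<in> {a \<in> B. a \<le> b}\<close> by auto
      qed
      ultimately show ?thesis by blast
    qed
    define lst where "lst B = (SOME m. m \<in> B \<and> (\<forall>b\<in>B. m \<le> b))" for B :: "real set"
    have lst: "lst B \<in> B" "\<And>b. b \<in> B \<Longrightarrow> lst B \<le> b" if "B \<subseteq> A" "B \<noteq> {}" for B
    proof -
      have "lst B \<in> B \<and> (\<forall>b\<in>B. lst B \<le> b)"
        unfolding lst_def by (rule someI_ex) (use ex[OF that] in blast)
      then show "lst B \<in> B" "\<And>b. b \<in> B \<Longrightarrow> lst B \<le> b" by auto
    qed
    have ne: "{b \<in> A. x < b} \<noteq> {}" for x
    proof
      assume "{b \<in> A. x < b} = {}"
      then have "A = {a \<in> A. a \<le> x}" by force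
      with fin False show False by metis
    qed
    define a where "a = rec_nat (lst A) (\<lambda>_ x. lst {b \<in> A. x < b})"
    have a0: "a 0 = lst A" and aS: "a (Suc n) = lst {b \<in> A. a n < b}" for n
      by (simp_all add: a_def)
    have inA: "a n \<in> A" for n
    proof (cases n)
      case 0
      then show ?thesis using a0 lst(1)[of A] False by fastforce
    next
      case (Suc k)
      have "lst {b \<in> A. a k < b} \<in> {b \<in> A. a k < b}" by (rule lst(1)) (use ne in auto)
      then show ?thesis using Suc aS by auto
    qed
    have sm: "strict_mono a"
    proof (rule strict_mono_Suc_iff[THEN iffD2], intro allI)
      fix n
      have "lst {b \<in> A. a n < b} \<in> {b \<in> A. a n < b}" by (rule lst(1)) (use ne in auto)
      then show "a n < a (Suc n)" using aS by auto
    qed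
    have inf: "infinite (range a)"
      using sm strict_mono_imp_inj_on finite_imageD infinite_UNIV_nat by blast
    have rng: "x \<in> range a" if "x \<in> A" for x
    proof (rule ccontr)
      assume nx: "x \<notin> range a"
      have lt: "a n < x" for n
      proof (induction n)
        case 0
        have "a 0 \<le> x" using a0 lst(2)[of A x] that by auto
        then show ?case using nx by (metis order_le_less rangeI)
      next
        case (Suc n)
        have "a (Suc n) \<le> x" unfolding aS by (rule lst(2)) (use ne that Suc in auto)
        then show ?case using nx by (metis order_le_less rangeI)
      qed
      have "range a \<subseteq> {a \<in> A. a \<le> x}" using inA lt by (force intro: less_imp_le)
      with fin inf show False using finite_subset by blast
    qed
    have eq: "A = range a" using rng inA by blast
    have "\<not> bounded (range a)"
    proof
      assume "bounded (range a)"
      then obtain c where "\<forall>y\<in>range a. \<bar>y\<bar> \<le> c" by (auto simp: bounded_iff)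
      then have "y \<le> c" if "y \<in> A" for y using that eq abs_le_D1 by blast
      then have "A = {a \<in> A. a \<le> c}" by blast
      with fin False show False by metis
    qed
    with sm eq show ?thesis by (auto simp: puiseux_supports_def)
  qed
qed

lemma puiseux_supports_subset:
  assumes "A \<in> puiseux_supports" "B \<subseteq> A"
  shows "B \<in> puiseux_supports"
  unfolding puiseux_supports_iff
proof
  fix x
  show "finite {b \<in> B. b \<le> x}"
    by (rule finite_subset[of _ "{a \<in> A. a \<le> x}"])
       (use assms puiseux_supports_iff in auto)
qed

lemma puiseux_supports_Un:
  assumes "A \<in> puiseux_supports" "B \<in> puiseux_supports"
  shows "A \<union> B \<in> puiseux_supports"
proof -
  have "{a \<in> A \<union> B. a \<le> x} = {a \<in> A. a \<le> x} \<union> {a \<in> B. a \<le> x}" for x by auto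
  then show ?thesis using assms unfolding puiseux_supports_iff by auto
qed

lemma puiseux_supports_finite: "finite A \<Longrightarrow> A \<in> puiseux_supports"
  by (simp add: puiseux_supports_def)

lemma puiseux_supports_least:
  assumes "A \<in> puiseux_supports" "A \<noteq> {}"
  obtains m where "m \<in> A" "\<And>a. a \<in> A \<Longrightarrow> m \<le> a"
proof -
  obtain b where b: "b \<in> A" using assms(2) by blast
  have f: "finite {a \<in> A. a \<le> b}" using assms(1) puiseux_supports_iff by auto
  have "Min {a \<in> A. a \<le> b} \<in> {a \<in> A. a \<le> b}" using f b by (intro Min_in) auto
  moreover have "Min {a \<in> A. a \<le> b} \<le> a" if "a \<in> A" for a
  proof (cases "a \<le> b")
    case True
    then show ?thesis using f that by (intro Min_le) auto
  next
    case False
    have "Min {a \<in> A. a \<le> b} \<le> b" using f b by (intro Min_le) auto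
    with False show ?thesis by linarith
  qed
  ultimately show ?thesis using that by blast
qed

lemma puiseux_supports_pairs:
  assumes "A \<in> puiseux_supports" "B \<in> puiseux_supports"
  shows "finite {(a, b). a \<in> A \<and> b \<in> B \<and> a + b \<le> x}"
proof (cases "A = {} \<or> B = {}")
  case True
  then have "{(a, b). a \<in> A \<and> b \<in> B \<and> a + b \<le> x} = {}" by auto
  then show ?thesis by (simp only: finite.emptyI)
next
  case False
  obtain m where m: "\<And>a. a \<in> A \<Longrightarrow> m \<le> a" using puiseux_supports_least assms False by metis
  obtain n where n: "\<And>a. a \<in> B \<Longrightarrow> n \<le> a" using puiseux_supports_least assms False by metis
  have "{(a, b). a \<in> A \<and> b \<in> B \<and> a + b \<le> x} \<subseteq> {a \<in> A. a \<le> x - n} \<times> {b \<in> B. b \<le> x - m}"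
    using m n by force
  moreover have "finite ({a \<in> A. a \<le> x - n} \<times> {b \<in> B. b \<le> x - m})"
    using assms unfolding puiseux_supports_iff by blast
  ultimately show ?thesis using finite_subset by blast
qed

lemma puiseux_supports_pairs_eq:
  assumes "A \<in> puiseux_supports" "B \<in> puiseux_supports"
  shows "finite {(a, b). a \<in> A \<and> b \<in> B \<and> a + b = x}"
  by (rule finite_subset[OF _ puiseux_supports_pairs[OF assms, of x]]) auto

lemma puiseux_supports_sumset:
  assumes "A \<in> puiseux_supports" "B \<in> puiseux_supports"
  shows "{a + b | a b. a \<in> A \<and> b \<in> B} \<in> puiseux_supports"
  unfolding puiseux_supports_iff
proof
  fix x
  have "{c \<in> {a + b | a b. a \<in> A \<and> b \<in> B}. c \<le> x}
      \<subseteq> (\<lambda>(a, b). a + b) ` {(a, b). a \<in> A \<and> b \<in> B \<and> a + b \<le> x}"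
    by force
  then show "finite {c \<in> {a + b | a b. a \<in> A \<and> b \<in> B}. c \<le> x}"
    using puiseux_supports_pairs[OF assms] finite_surj by blast
qed

instantiation gen_puiseux :: "{zero, one, plus, uminus, minus, times}"
begin

definition zero_gen_puiseux :: gen_puiseux where
  "0 = Abs_gen_puiseux (\<lambda>_. 0)"

definition one_gen_puiseux :: gen_puiseux where
  "1 = Abs_gen_puiseux (\<lambda>\<alpha>. if \<alpha> = 0 then 1 else 0)"

definition plus_gen_puiseux :: "gen_puiseux \<Rightarrow> gen_puiseux \<Rightarrow> gen_puiseux" where
  "f + g = Abs_gen_puiseux (\<lambda>\<alpha>. coeff f \<alpha> + coeff g \<alpha>)"

definition uminus_gen_puiseux :: "gen_puiseux \<Rightarrow> gen_puiseux" where
  "- f = Abs_gen_puiseux (\<lambda>\<alpha>. - coeff f \<alpha>)"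

definition minus_gen_puiseux :: "gen_puiseux \<Rightarrow> gen_puiseux \<Rightarrow> gen_puiseux" where
  "f - g = Abs_gen_puiseux (\<lambda>\<alpha>. coeff f \<alpha> - coeff g \<alpha>)"

definition times_gen_puiseux :: "gen_puiseux \<Rightarrow> gen_puiseux \<Rightarrow> gen_puiseux" where
  "f * g = Abs_gen_puiseux (\<lambda>\<gamma>.
     \<Sum>(\<alpha>, \<beta>) \<in> {(\<alpha>, \<beta>). \<alpha> \<in> supp f \<and> \<beta> \<in> supp g \<and> \<alpha> + \<beta> = \<gamma>}. coeff f \<alpha> * coeff g \<beta>)"

instance ..

end

lemma coeff_zero [simp]: "coeff 0 \<alpha> = 0"
  unfolding zero_gen_puiseux_def by (subst coeff_Abs) (auto intro: puiseux_supports_finite)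

lemma coeff_one: "coeff 1 \<alpha> = (if \<alpha> = 0 then 1 else 0)"
  unfolding one_gen_puiseux_def by (subst coeff_Abs) (auto intro: puiseux_supports_finite)

lemma coeff_add [simp]: "coeff (f + g) \<alpha> = coeff f \<alpha> + coeff g \<alpha>"
  unfolding plus_gen_puiseux_def
  by (subst coeff_Abs)
     (auto simp: supp_def intro: puiseux_supports_subset[OF puiseux_supports_Un[OF supp_in[of f] supp_in[of g]]])

lemma coeff_uminus [simp]: "coeff (- f) \<alpha> = - coeff f \<alpha>"
  unfolding uminus_gen_puiseux_def
  by (subst coeff_Abs) (use supp_in[of f] in \<open>auto simp: supp_def\<close>)

lemma coeff_diff [simp]: "coeff (f - g) \<alpha> = coeff f \<alpha> - coeff g \<alpha>"
  unfolding minus_gen_puiseux_def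
  by (subst coeff_Abs)
     (auto simp: supp_def intro: puiseux_supports_subset[OF puiseux_supports_Un[OF supp_in[of f] supp_in[of g]]])

lemma coeff_mult:
  "coeff (f * g) \<gamma> =
    (\<Sum>(\<alpha>, \<beta>) \<in> {(\<alpha>, \<beta>). \<alpha> \<in> supp f \<and> \<beta> \<in> supp g \<and> \<alpha> + \<beta> = \<gamma>}. coeff f \<alpha> * coeff g \<beta>)"
  unfolding times_gen_puiseux_def
proof (subst coeff_Abs)
  have "{\<gamma>. (\<Sum>(\<alpha>, \<beta>) \<in> {(\<alpha>, \<beta>). \<alpha> \<in> supp f \<and> \<beta> \<in> supp g \<and> \<alpha> + \<beta> = \<gamma>}.
           coeff f \<alpha> * coeff g \<beta>) \<noteq> 0} \<subseteq> {a + b | a b. a \<in> supp f \<and> b \<in> supp g}"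
  proof
    fix c assume "c \<in> {\<gamma>. (\<Sum>(\<alpha>, \<beta>) \<in> {(\<alpha>, \<beta>). \<alpha> \<in> supp f \<and> \<beta> \<in> supp g \<and> \<alpha> + \<beta> = \<gamma>}.
           coeff f \<alpha> * coeff g \<beta>) \<noteq> 0}"
    then have "{(\<alpha>, \<beta>). \<alpha> \<in> supp f \<and> \<beta> \<in> supp g \<and> \<alpha> + \<beta> = c} \<noteq> {}"
      by (metis (mono_tags, lifting) mem_Collect_eq sum.empty)
    then show "c \<in> {a + b | a b. a \<in> supp f \<and> b \<in> supp g}" by auto
  qed
  then show "{\<gamma>. (\<Sum>(\<alpha>, \<beta>) \<in> {(\<alpha>, \<beta>). \<alpha> \<in> supp f \<and> \<beta> \<in> supp g \<and> \<alpha> + \<beta> = \<gamma>}.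
           coeff f \<alpha> * coeff g \<beta>) \<noteq> 0} \<in> puiseux_supports"
    using puiseux_supports_sumset[OF supp_in supp_in] puiseux_supports_subset by blast
qed simp

lemma coeff_mult_superset:
  assumes "A \<in> puiseux_supports" "B \<in> puiseux_supports" "supp f \<subseteq> A" "supp g \<subseteq> B"
  shows "coeff (f * g) \<gamma> =
    (\<Sum>(\<alpha>, \<beta>) \<in> {(\<alpha>, \<beta>). \<alpha> \<in> A \<and> \<beta> \<in> B \<and> \<alpha> + \<beta> = \<gamma>}. coeff f \<alpha> * coeff g \<beta>)"
  unfolding coeff_mult
  by (rule sum.mono_neutral_left)
     (use puiseux_supports_pairs_eq[OF assms(1,2)] assms(3,4) in \<open>auto simp: supp_def\<close>)

lemma supp_mult_ge:
  assumes "\<And>a. a \<in> supp f \<Longrightarrow> x \<le> a" "\<And>b. b \<in> supp g \<Longrightarrow> y \<le> b" "c \<in> supp (f * g)"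
  shows "x + y \<le> c"
proof -
  have "coeff (f * g) c \<noteq> 0" using assms(3) by (simp add: supp_def)
  then have "{(\<alpha>, \<beta>). \<alpha> \<in> supp f \<and> \<beta> \<in> supp g \<and> \<alpha> + \<beta> = c} \<noteq> {}"
    unfolding coeff_mult by (metis (mono_tags, lifting) sum.empty)
  then obtain a b where "a \<in> supp f" "b \<in> supp g" "a + b = c" by auto
  with assms show ?thesis by fastforce
qed

lemma supp_mult_subset: "supp (f * g) \<subseteq> {a + b | a b. a \<in> supp f \<and> b \<in> supp g}"
proof
  fix c assume "c \<in> supp (f * g)"
  then have "coeff (f * g) c \<noteq> 0" by (simp add: supp_def)
  then have "{(\<alpha>, \<beta>). \<alpha> \<in> supp f \<and> \<beta> \<in> supp g \<and> \<alpha> + \<beta> = c} \<noteq> {}"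
    unfolding coeff_mult by (metis (mono_tags, lifting) sum.empty)
  then show "c \<in> {a + b | a b. a \<in> supp f \<and> b \<in> supp g}" by auto
qed

definition puiseux_monom :: "complex \<Rightarrow> real \<Rightarrow> gen_puiseux" where
  "puiseux_monom c v = Abs_gen_puiseux (\<lambda>\<alpha>. if \<alpha> = v then c else 0)"

lemma coeff_monom: "coeff (puiseux_monom c v) \<alpha> = (if \<alpha> = v then c else 0)"
  unfolding puiseux_monom_def
  by (subst coeff_Abs) (auto intro: puiseux_supports_finite)

lemma one_eq_monom: "1 = puiseux_monom 1 0"
  by (rule gen_puiseux_eqI) (simp add: coeff_one coeff_monom)

lemma coeff_monom_mult: "coeff (puiseux_monom c v * f) \<gamma> = c * coeff f (\<gamma> - v)"
proof -
  let ?B = "insert (\<gamma> - v) (supp f)"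
  have B: "?B \<in> puiseux_supports"
    using puiseux_supports_Un[OF puiseux_supports_finite[of "{\<gamma> - v}"] supp_in] by simp
  have "coeff (puiseux_monom c v * f) \<gamma> =
    (\<Sum>(\<alpha>, \<beta>) \<in> {(\<alpha>, \<beta>). \<alpha> \<in> {v} \<and> \<beta> \<in> ?B \<and> \<alpha> + \<beta> = \<gamma>}. coeff (puiseux_monom c v) \<alpha> * coeff f \<beta>)"
    by (rule coeff_mult_superset)
       (use B in \<open>auto simp: supp_def coeff_monom split: if_splits intro: puiseux_supports_finite\<close>)
  also have "{(\<alpha>, \<beta>). \<alpha> \<in> {v} \<and> \<beta> \<in> ?B \<and> \<alpha> + \<beta> = \<gamma>} = {(v, \<gamma> - v)}" by auto
  finally show ?thesis by (simp add: coeff_monom)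
qed

lemma gen_puiseux_mult_assoc: "(f * g) * h = f * (g * h)" for f g h :: gen_puiseux
proof (rule gen_puiseux_eqI)
  fix c
  let ?A = "supp f" and ?B = "supp g" and ?C = "supp h"
  let ?D = "{a + b | a b. a \<in> ?A \<and> b \<in> ?B}" and ?E = "{a + b | a b. a \<in> ?B \<and> b \<in> ?C}"
  have D: "?D \<in> puiseux_supports" and E: "?E \<in> puiseux_supports"
    by (intro puiseux_supports_sumset supp_in)+
  let ?P = "\<lambda>X Y c. {(\<alpha>, \<beta>). \<alpha> \<in> X \<and> \<beta> \<in> Y \<and> \<alpha> + \<beta> = (c::real)}"
  have "coeff ((f * g) * h) c = (\<Sum>(d, e)\<in>?P ?D ?C c. coeff (f * g) d * coeff h e)"
    by (rule coeff_mult_superset[OF D supp_in supp_mult_subset]) simp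
  also have "\<dots> = (\<Sum>p\<in>?P ?D ?C c. \<Sum>q\<in>?P ?A ?B (fst p). coeff f (fst q) * coeff g (snd q) * coeff h (snd p))"
    by (intro sum.cong) (auto simp: coeff_mult[of f g] sum_distrib_right split: prod.splits intro!: sum.cong)
  also have "\<dots> = (\<Sum>(p, q)\<in>(SIGMA p:?P ?D ?C c. ?P ?A ?B (fst p)). coeff f (fst q) * coeff g (snd q) * coeff h (snd p))"
    by (rule sum.Sigma) (intro ballI puiseux_supports_pairs_eq D supp_in)+
  also have "\<dots> = (\<Sum>(p, q)\<in>(SIGMA p:?P ?A ?E c. ?P ?B ?C (snd p)). coeff f (fst p) * (coeff g (fst q) * coeff h (snd q)))"
    by (rule sum.reindex_bij_witness
        [where i = "\<lambda>((a, d), (b, e)). ((a + b, e), (a, b))"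
           and j = "\<lambda>((d, e), (a, b)). ((a, b + e), (b, e))"]) auto
  also have "\<dots> = (\<Sum>p\<in>?P ?A ?E c. \<Sum>q\<in>?P ?B ?C (snd p). coeff f (fst p) * (coeff g (fst q) * coeff h (snd q)))"
    by (rule sum.Sigma[symmetric]) (intro ballI puiseux_supports_pairs_eq E supp_in)+
  also have "\<dots> = (\<Sum>(a, d)\<in>?P ?A ?E c. coeff f a * coeff (g * h) d)"
    by (intro sum.cong) (auto simp: coeff_mult[of g h] sum_distrib_left split: prod.splits intro!: sum.cong)
  also have "\<dots> = coeff (f * (g * h)) c"
    by (rule coeff_mult_superset[OF supp_in E _ supp_mult_subset, symmetric]) simp
  finally show "coeff ((f * g) * h) c = coeff (f * (g * h)) c" .
qed

lemma gen_puiseux_mult_commute: "f * g = g * f" for f g :: gen_puiseux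
  by (rule gen_puiseux_eqI, unfold coeff_mult)
     (rule sum.reindex_bij_witness[where i = prod.swap and j = prod.swap]; auto)

lemma gen_puiseux_distrib: "(f + g) * h = f * h + g * h" for f g h :: gen_puiseux
proof (rule gen_puiseux_eqI)
  fix c
  let ?A = "supp f \<union> supp g"
  have A: "?A \<in> puiseux_supports" by (intro puiseux_supports_Un supp_in)
  have s: "supp (f + g) \<subseteq> ?A" by (auto simp: supp_def)
  show "coeff ((f + g) * h) c = coeff (f * h + g * h) c"
    by (simp add: coeff_mult_superset[OF A supp_in[of h] s] coeff_mult_superset[OF A supp_in[of h], of f]
        coeff_mult_superset[OF A supp_in[of h], of g] sum.distrib[symmetric] case_prod_unfold ring_distribs)
qed

instance gen_puiseux :: comm_ring_1
proof
  fix f g h :: gen_puiseux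
  show "f + g + h = f + (g + h)" "f + g = g + f" "0 + f = f" "- f + f = 0" "f - g = f + - g"
    by (rule gen_puiseux_eqI; simp)+
  show "f * g * h = f * (g * h)" by (rule gen_puiseux_mult_assoc)
  show "f * g = g * f" by (rule gen_puiseux_mult_commute)
  show "1 * f = f" by (rule gen_puiseux_eqI) (simp add: one_eq_monom coeff_monom_mult)
  show "(f + g) * h = f * h + g * h" by (rule gen_puiseux_distrib)
  show "(0::gen_puiseux) \<noteq> 1"
  proof
    assume "(0::gen_puiseux) = 1"
    then have "coeff 0 0 = coeff 1 0" by simp
    then show False by (simp add: coeff_one)
  qed
qed

lemma supp_eq_empty_iff: "supp f = {} \<longleftrightarrow> f = 0"
  by (auto simp: supp_def intro: gen_puiseux_eqI)

lemma supp_power_ge: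
  assumes "\<And>a. a \<in> supp u \<Longrightarrow> v \<le> a" "c \<in> supp (u ^ n)"
  shows "real n * v \<le> c"
  using assms(2)
proof (induction n arbitrary: c)
  case 0
  then show ?case by (auto simp: supp_def coeff_one split: if_splits)
next
  case (Suc n)
  have "v + real n * v \<le> c"
    by (rule supp_mult_ge[of u v "u ^ n"]) (use assms(1) Suc in auto)
  then show ?case by (simp add: algebra_simps)
qed

lemma coeff_mult_cong_le:
  assumes "\<And>a. a \<in> supp f \<Longrightarrow> 0 \<le> a" "\<And>b. b \<le> c \<Longrightarrow> coeff g b = coeff h b"
  shows "coeff (f * g) c = coeff (f * h) c"
proof -
  have "b > c" if "b \<in> supp (g - h)" for b
    using that assms(2)[of b] by (force simp: supp_def)
  then have "{(\<alpha>, \<beta>). \<alpha> \<in> supp f \<and> \<beta> \<in> supp (g - h) \<and> \<alpha> + \<beta> = c} = {}"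
    using assms(1) by fastforce
  then have "coeff (f * (g - h)) c = 0" unfolding coeff_mult by (metis sum.empty)
  then show ?thesis by (simp add: right_diff_distrib)
qed

lemma geometric_inverse:
  assumes pos: "\<And>a. a \<in> supp u \<Longrightarrow> 0 < a"
  obtains g where "(1 - u) * g = 1"
proof -
  obtain v where v: "v > 0" "\<And>a. a \<in> supp u \<Longrightarrow> v \<le> a"
  proof (cases "supp u = {}")
    case True
    then show ?thesis using that[of 1] by auto
  next
    case False
    then show ?thesis using puiseux_supports_least[OF supp_in] pos that by metis
  qed
  define S where "S N = (\<Sum>n<N. u ^ n)" for N
  define N where "N x = nat (\<lceil>x / v\<rceil> + 1)" for x
  have pw: "coeff (u ^ n) a = 0" if "a \<le> x" "N x \<le> n" for a x n
  proof (rule ccontr)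
    assume "coeff (u ^ n) a \<noteq> 0"
    then have "real n * v \<le> a" using supp_power_ge[of u v a n] v(2) by (simp add: supp_def)
    moreover have "x / v < real n" using that(2) unfolding N_def by linarith
    then have "x < real n * v" using v(1) by (simp add: field_simps)
    ultimately show False using that(1) by simp
  qed
  have st: "coeff (S M) a = coeff (S (N x)) a" if "a \<le> x" "N x \<le> M" for a x M
    using that(2)
  proof (induction M rule: dec_induct)
    case (step m)
    then show ?case using pw[OF that(1), of m] by (simp add: S_def)
  qed simp
  define g where "g a = coeff (S (N a)) a" for a
  have mono: "N a \<le> N x" if "a \<le> x" for a x
  proof -
    have "a / v \<le> x / v" using that v(1) by (simp add: divide_right_mono)
    then show ?thesis unfolding N_def by (intro nat_mono add_mono ceiling_mono) auto
  qed
  have gS: "g a = coeff (S (N x)) a" if "a \<le> x" for a x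
    unfolding g_def using st[of a a "N x"] mono[OF that] by simp
  have "{a. g a \<noteq> 0} \<in> puiseux_supports"
    unfolding puiseux_supports_iff
  proof
    fix x
    have "{a \<in> {a. g a \<noteq> 0}. a \<le> x} \<subseteq> {a \<in> supp (S (N x)). a \<le> x}"
      using gS by (auto simp: supp_def)
    moreover have "finite {a \<in> supp (S (N x)). a \<le> x}"
      using supp_in puiseux_supports_iff by blast
    ultimately show "finite {a \<in> {a. g a \<noteq> 0}. a \<le> x}" using finite_subset by blast
  qed
  then have cg: "coeff (Abs_gen_puiseux g) = g" by (rule coeff_Abs)
  have "(1 - u) * Abs_gen_puiseux g = 1"
  proof (rule gen_puiseux_eqI)
    fix c
    have geo: "(1 - u) * S M = 1 - u ^ M" for M
      unfolding S_def by (rule one_diff_power_eq[symmetric])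
    have "coeff ((1 - u) * Abs_gen_puiseux g) c = coeff ((1 - u) * S (N c)) c"
    proof (rule coeff_mult_cong_le)
      show "0 \<le> a" if "a \<in> supp (1 - u)" for a
        using that pos[of a] by (cases "a = 0") (auto simp: supp_def coeff_one less_imp_le)
      show "coeff (Abs_gen_puiseux g) b = coeff (S (N c)) b" if "b \<le> c" for b
        using gS[OF that] cg by simp
    qed
    also have "\<dots> = coeff 1 c" using pw[of c c "N c"] by (simp add: geo)
    finally show "coeff ((1 - u) * Abs_gen_puiseux g) c = coeff 1 c" .
  qed
  then show ?thesis by (rule that)
qed

lemma gen_puiseux_inverse_exists:
  fixes f :: gen_puiseux
  assumes "f \<noteq> 0"
  shows "\<exists>g. f * g = 1"
proof -
  have "supp f \<noteq> {}" using assms by (simp add: supp_eq_empty_iff)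
  then obtain m where m: "m \<in> supp f" "\<And>a. a \<in> supp f \<Longrightarrow> m \<le> a"
    using puiseux_supports_least[OF supp_in] by metis
  let ?t = "puiseux_monom (1 / coeff f m) (- m)"
  define u where "u = 1 - ?t * f"
  have "0 < a" if "a \<in> supp u" for a
  proof (rule ccontr)
    assume n: "\<not> 0 < a"
    have c: "coeff u a = (if a = 0 then 1 else 0) - coeff f (a + m) / coeff f m"
      by (simp add: u_def coeff_monom_mult coeff_one)
    show False
    proof (cases "a = 0")
      case True
      then show False using c m(1) that by (simp add: supp_def)
    next
      case False
      then have "a + m < m" using n by simp
      then have "coeff f (a + m) = 0" using m(2)[of "a + m"] not_in_supp by force
      then show False using c that False by (simp add: supp_def)
    qed
  qed
  then obtain g where "(1 - u) * g = 1" by (rule geometric_inverse)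
  then have "f * (?t * g) = 1" by (simp add: u_def ac_simps)
  then show ?thesis by blast
qed

instantiation gen_puiseux :: inverse
begin

definition inverse_gen_puiseux :: "gen_puiseux \<Rightarrow> gen_puiseux" where
  "inverse f = (if f = 0 then 0 else (THE g :: gen_puiseux. f * g = 1))"

definition divide_gen_puiseux :: "gen_puiseux \<Rightarrow> gen_puiseux \<Rightarrow> gen_puiseux" where
  "f div g = f * inverse (g :: gen_puiseux)"

instance ..

end

instance gen_puiseux :: field
proof
  fix f g :: gen_puiseux
  show "inverse f * f = 1" if nz: "f \<noteq> 0"
  proof -
    obtain g where g: "f * g = 1" using gen_puiseux_inverse_exists nz by blast
    have "h = g" if "f * h = 1" for h
    proof -
      have "h = (f * g) * h" using g by simp
      also have "\<dots> = (f * h) * g" by (simp add: ac_simps)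
      finally show ?thesis using that by simp
    qed
    then have "(THE g. f * g = 1) = g" using g by blast
    then show ?thesis using nz g by (simp add: inverse_gen_puiseux_def mult.commute)
  qed
  show "f div g = f * inverse g" by (rule divide_gen_puiseux_def)
  show "inverse (0::gen_puiseux) = 0" by (simp add: inverse_gen_puiseux_def)
qed

definition val :: "gen_puiseux \<Rightarrow> ereal" where
  "val f = (if f = 0 then \<infinity> else ereal (LEAST \<alpha>. coeff f \<alpha> \<noteq> 0))"

text \<open>The library's \<open>norm\<close> is reserved for real normed vector spaces; this norm is not
  homogeneous with respect to scaling by reals, so it gets a name of its own.\<close>

definition pnorm :: "gen_puiseux \<Rightarrow> real" where
  "pnorm f = (if val f = \<infinity> then 0 else exp (- real_of_ereal (val f)))"

lemma val_nonzero:
  assumes "f \<noteq> 0"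
  obtains m where "val f = ereal m" "coeff f m \<noteq> 0" "\<And>a. coeff f a \<noteq> 0 \<Longrightarrow> m \<le> a"
proof -
  have "supp f \<noteq> {}" using assms by (simp add: supp_eq_empty_iff)
  then obtain m where m: "m \<in> supp f" "\<And>a. a \<in> supp f \<Longrightarrow> m \<le> a"
    using puiseux_supports_least[OF supp_in] by metis
  have "(LEAST \<alpha>. coeff f \<alpha> \<noteq> 0) = m"
    by (rule Least_equality) (use m in \<open>auto simp: supp_def\<close>)
  then show ?thesis using that[of m] m assms by (simp add: val_def supp_def)
qed

lemma pnorm_zero [simp]: "pnorm 0 = 0"
  by (simp add: pnorm_def val_def)

lemma pnorm_pos: "f \<noteq> 0 \<Longrightarrow> 0 < pnorm f"
  by (erule val_nonzero) (simp add: pnorm_def)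

lemma pnorm_eq_0_iff: "pnorm f = 0 \<longleftrightarrow> f = 0"
  using pnorm_pos by force

lemma pnorm_nonneg: "0 \<le> pnorm f"
  by (simp add: pnorm_def)

lemma pnorm_le_exp_iff: "pnorm f \<le> exp (- x) \<longleftrightarrow> (\<forall>a < x. coeff f a = 0)"
proof (cases "f = 0")
  case False
  then obtain m where m: "val f = ereal m" "coeff f m \<noteq> 0" "\<And>a. coeff f a \<noteq> 0 \<Longrightarrow> m \<le> a"
    by (rule val_nonzero) blast
  have "pnorm f \<le> exp (- x) \<longleftrightarrow> x \<le> m" using m(1) by (simp add: pnorm_def)
  also have "\<dots> \<longleftrightarrow> (\<forall>a < x. coeff f a = 0)" using m(2,3) by (meson leD le_less_trans not_le)
  finally show ?thesis .
qed auto

lemma pnorm_add_le: "pnorm (f + g) \<le> max (pnorm f) (pnorm g)"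
proof (cases "f = 0 \<and> g = 0")
  case False
  then have "0 < max (pnorm f) (pnorm g)" using pnorm_pos less_max_iff_disj by blast
  then obtain x where x: "max (pnorm f) (pnorm g) = exp (- x)"
    by (metis exp_ln minus_minus)
  then have "pnorm f \<le> exp (- x)" "pnorm g \<le> exp (- x)" by (metis max.cobounded1, metis max.cobounded2)
  then have "pnorm (f + g) \<le> exp (- x)" unfolding pnorm_le_exp_iff by simp
  then show ?thesis using x by simp
qed simp

lemma pnorm_uminus: "pnorm (- f) = pnorm f"
  by (simp add: pnorm_def val_def)

instantiation gen_puiseux :: metric_space
begin

definition dist_gen_puiseux :: "gen_puiseux \<Rightarrow> gen_puiseux \<Rightarrow> real" where
  "dist f g = pnorm (f - g)"

definition uniformity_gen_puiseux :: "(gen_puiseux \<times> gen_puiseux) filter" where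
  "uniformity = (INF e\<in>{0 <..}. principal {(f, g). dist f (g :: gen_puiseux) < e})"

definition open_gen_puiseux :: "gen_puiseux set \<Rightarrow> bool" where
  "open U \<longleftrightarrow> (\<forall>f\<in>(U :: gen_puiseux set). eventually (\<lambda>(f', g). f' = f \<longrightarrow> g \<in> U) uniformity)"

instance
proof
  fix f g h :: gen_puiseux and U :: "gen_puiseux set"
  show "uniformity = (INF e\<in>{0 <..}. principal {(f, g). dist f (g :: gen_puiseux) < e})"
    by (rule uniformity_gen_puiseux_def)
  show "open U \<longleftrightarrow> (\<forall>f\<in>(U :: gen_puiseux set). eventually (\<lambda>(f', g). f' = f \<longrightarrow> g \<in> U) uniformity)"
    by (rule open_gen_puiseux_def)
  show "dist f g = 0 \<longleftrightarrow> f = g" by (simp add: dist_gen_puiseux_def pnorm_eq_0_iff)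
  have "pnorm (f - g) \<le> max (pnorm (f - h)) (pnorm (h - g))"
    using pnorm_add_le[of "f - h" "h - g"] by simp
  also have "\<dots> \<le> pnorm (f - h) + pnorm (h - g)" using pnorm_nonneg by (simp add: max_def)
  also have "pnorm (h - g) = pnorm (g - h)" using pnorm_uminus[of "g - h"] by simp
  finally show "dist f g \<le> dist f h + dist g h" by (simp add: dist_gen_puiseux_def)
qed

end

lemma Cauchy_gen_puiseux_iff:
  fixes f :: "nat \<Rightarrow> gen_puiseux"
  shows "Cauchy f \<longleftrightarrow> (\<forall>\<epsilon>>0. \<exists>N. \<forall>n\<ge>N. \<forall>m\<ge>N. pnorm (f n - f m) < \<epsilon>)"
  unfolding Cauchy_def dist_gen_puiseux_def by blast

lemma convergent_gen_puiseux_iff: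
  fixes f :: "nat \<Rightarrow> gen_puiseux"
  shows "convergent f \<longleftrightarrow> (\<exists>g. \<forall>\<epsilon>>0. \<exists>N. \<forall>n\<ge>N. pnorm (f n - g) < \<epsilon>)"
  unfolding convergent_def lim_sequentially dist_gen_puiseux_def by blast

end

theory Submission
  imports Defs
begin

text \<open>Being close in the norm means agreeing on an initial segment of exponents:
  \<open>pnorm h \<le> exp (- x)\<close> says precisely that \<open>h\<close> has no exponents below \<open>x\<close>. Hence along a Cauchy
  sequence the coefficients at all exponents up to a given bound are eventually constant,
  uniformly in the exponent (\<open>Cauchy_coeff_stable\<close>). The limit collects these eventual values.
  Below any bound it coincides with a single member of the sequence, so its support has only
  finitely many exponents below that bound and it is again a generalised Puiseux series
  (\<open>gen_puiseux_locally_coeff\<close>). The same agreement on initial segments is convergence in norm.\<close>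

lemma Cauchy_coeff_stable:
  fixes f :: "nat \<Rightarrow> gen_puiseux"
  assumes "Cauchy f"
  shows "\<exists>N. \<forall>n\<ge>N. \<forall>a\<le>x. coeff (f n) a = coeff (f N) a"
proof -
  \<comment> \<open>The norm bound controls exponents strictly below its parameter; \<open>x + 1\<close> makes \<open>x\<close> one of them.\<close>
  obtain N where N: "\<And>n m. n \<ge> N \<Longrightarrow> m \<ge> N \<Longrightarrow> pnorm (f n - f m) < exp (- (x + 1))"
    using assms unfolding Cauchy_gen_puiseux_iff by (meson exp_gt_zero)
  have "coeff (f n) a = coeff (f N) a" if "n \<ge> N" "a \<le> x" for n a
  proof -
    have "pnorm (f n - f N) \<le> exp (- (x + 1))" using N[of n N] that(1) by simp
    then have "coeff (f n - f N) a = 0" using that(2) unfolding pnorm_le_exp_iff by force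
    then show ?thesis by simp
  qed
  then show ?thesis by blast
qed

text \<open>Membership in \<open>puiseux_supports\<close> is a condition on each half-line of exponents separately,
  so it may be tested there against a different series for each half-line.\<close>

lemma gen_puiseux_locally_coeff:
  assumes "\<And>x. \<exists>h. \<forall>a\<le>x. g a = coeff h a"
  obtains G where "coeff G = g"
proof -
  have "{a. g a \<noteq> 0} \<in> puiseux_supports"
    unfolding puiseux_supports_iff
  proof
    fix x
    obtain h where "\<forall>a\<le>x. g a = coeff h a" using assms by blast
    then have "{a \<in> {a. g a \<noteq> 0}. a \<le> x} = {a \<in> supp h. a \<le> x}"
      by (auto simp: supp_def)
    then show "finite {a \<in> {a. g a \<noteq> 0}. a \<le> x}"
      using supp_in[of h] unfolding puiseux_supports_iff by simp
  qed
  then show ?thesis using that coeff_Abs by blast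
qed

theorem proposition11:
  fixes f :: "nat \<Rightarrow> gen_puiseux"
  assumes "Cauchy f"
  shows "convergent f"
proof -
  obtain N where N: "\<And>x n a. n \<ge> N x \<Longrightarrow> a \<le> x \<Longrightarrow> coeff (f n) a = coeff (f (N x)) a"
    using Cauchy_coeff_stable[OF assms] by metis
  define g where "g a = coeff (f (N a)) a" for a
  have g: "g a = coeff (f n) a" if "n \<ge> N x" "a \<le> x" for a x n
  proof -
    \<comment> \<open>\<open>N\<close> need not be monotone, so both stages are compared with a common later one.\<close>
    let ?m = "max (N a) n"
    have "g a = coeff (f ?m) a" using N[of a ?m a] by (simp add: g_def)
    also have "\<dots> = coeff (f n) a" using N[of x ?m a] N[of x n a] that by simp
    finally show ?thesis .
  qed
  obtain G where G: "coeff G = g"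
    using gen_puiseux_locally_coeff[of g] g by blast
  have "\<exists>M. \<forall>n\<ge>M. pnorm (f n - G) < \<epsilon>" if "\<epsilon> > 0" for \<epsilon>
  proof -
    \<comment> \<open>\<open>exp (- x) = \<epsilon> / 2\<close>; halving turns the weak bound into a strict one.\<close>
    define x where "x = - ln (\<epsilon> / 2)"
    have x: "exp (- x) < \<epsilon>" using that by (simp add: x_def)
    have "pnorm (f n - G) \<le> exp (- x)" if "n \<ge> N x" for n
      unfolding pnorm_le_exp_iff using g[OF that] G by simp
    then show ?thesis using x by (meson le_less_trans)
  qed
  then show ?thesis unfolding convergent_gen_puiseux_iff by blast
qed

end
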